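(* Let $f=\sum_{s=1}^{t}\lambda_s F_s\in\mathcal{A}_\emptyset$ be a graph combination of pairwise distinct (non-isomorphic) unlabeled graphs $F_s$ with real coefficients $\lambda_s$, and let $d_{\min}$ be the minimum degree (number of edges) of any $F_s$. Suppose that (1) there exists an $s$ such that the degree of $F_s$ equals $d_{\min}$ and $\lambda_s<0$; and (2) for every $s$ such that the degree of $F_s$ equals $d_{\min}$ and $\lambda_s>0$, the graph $F_s$ is a trivial square. Then $f$ is not a sum of squares (sos).
   Context: All graphs are finite and simple (no loops or multiple edges). A graph is partially labeled if some subset of its vertices (possibly empty, possibly all) carries pairwise distinct labels from $\mathbb{N}=\{1,2,3,\dots\}$, each vertex having at most one label; it is unlabeled if no vertex is labeled and fully labeled if all are. Partially labeled graphs are identified up to label-preserving isomorphism. $\mathcal{A}$ is the real vector space of formal finite $\mathbb{R}$-linear combinations ("graph combinations") of partially labeled graphs without isolated vertices, including the empty graph, denoted $1$. The product $H_1H_2$ of two partially labeled graphs is obtained by taking the disjoint union, identifying vertices carrying the same label, and keeping only one copy of any doubled edge; extended bilinearly, this makes $\mathcal{A}$ a commutative $\mathbb{R}$-algebra with identity $1$. $\mathcal{A}_\emptyset$ is the subalgebra spanned by unlabeled graphs (where the product is disjoint union). The linear map $[[\cdot]]:\mathcal{A}\to\mathcal{A}_\emptyset$ removes all labels. The degree of a graph is its number of edges. A sum of squares (sos) is an element of $\mathcal{A}_\emptyset$ of the form $\sum_i[[a_i^2]]$, a finite sum with $a_i\in\mathcal{A}$. An unlabeled graph $F$ is a trivial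 square if whenever $F=[[H^2]]$ for some partially labeled graph $H$, then $H$ is a fully labeled copy of $F$. *)

theory Defs
  imports Complex_Main "HOL-Library.Poly_Mapping"
begin

text \<open>
  A graph without isolated vertices is determined by its set of edges, and in a partially labeled
  graph a label occurs at most once. So the vertex carrying the label \<open>l\<close> is taken to be
  \<open>Labeled l\<close>, and a partially labeled graph without isolated vertices is represented by a finite
  set of two-element sets of vertices. Labels are the positive integers.
\<close>

datatype vertex = Labeled nat | Unlabeled nat

fun vlabel :: "vertex \<Rightarrow> nat option" where
  "vlabel (Labeled l) = Some l"
| "vlabel (Unlabeled i) = None"

definition pl_edges :: "vertex set set \<Rightarrow> bool" where
  "pl_edges E \<longleftrightarrow> finite E \<and> (\<forall>e\<in>E. card e = 2) \<and> Labeled 0 \<notin> \<Union>E"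

definition map_edges :: "(vertex \<Rightarrow> vertex) \<Rightarrow> vertex set set \<Rightarrow> vertex set set" where
  "map_edges f E = (\<lambda>e. f ` e) ` E"

definition pl_iso :: "vertex set set \<Rightarrow> vertex set set \<Rightarrow> bool" where
  "pl_iso E E' \<longleftrightarrow> pl_edges E \<and> pl_edges E' \<and>
     (\<exists>\<pi>. bij_betw \<pi> (\<Union>E) (\<Union>E') \<and> (\<forall>v\<in>\<Union>E. vlabel (\<pi> v) = vlabel v) \<and> map_edges \<pi> E = E')"

text \<open>
  \<open>rename g\<close> renames the unlabeled vertices only. The product makes the unlabeled vertices
  disjoint (even and odd indices) and takes the union of the edge sets; vertices with equal labels
  are equal, hence are identified, and a doubled edge is kept once.
\<close>

fun rename :: "(nat \<Rightarrow> nat) \<Rightarrow> vertex \<Rightarrow> vertex" where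
  "rename g (Labeled l) = Labeled l"
| "rename g (Unlabeled i) = Unlabeled (g i)"

definition glue_edges :: "vertex set set \<Rightarrow> vertex set set \<Rightarrow> vertex set set" where
  "glue_edges A B = map_edges (rename (\<lambda>i. 2 * i)) A \<union> map_edges (rename (\<lambda>i. 2 * i + 1)) B"

fun forget :: "vertex \<Rightarrow> vertex" where
  "forget (Labeled l) = Unlabeled (2 * l)"
| "forget (Unlabeled i) = Unlabeled (2 * i + 1)"

lemma Union_map_edges: "\<Union> (map_edges f E) = f ` \<Union>E"
  unfolding map_edges_def by blast

lemma map_edges_comp: "map_edges f (map_edges g E) = map_edges (\<lambda>v. f (g v)) E"
  unfolding map_edges_def by (simp add: image_image)

lemma map_edges_Un: "map_edges f (A \<union> B) = map_edges f A \<union> map_edges f B"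
  unfolding map_edges_def by (rule image_Un)

lemma map_edges_cong: "(\<And>v. v \<in> \<Union>E \<Longrightarrow> f v = g v) \<Longrightarrow> map_edges f E = map_edges g E"
  unfolding map_edges_def by (intro image_cong refl) blast

lemma map_edges_id: "(\<And>v. v \<in> \<Union>E \<Longrightarrow> f v = v) \<Longrightarrow> map_edges f E = E"
  using map_edges_cong[of E f "\<lambda>v. v"] by (simp add: map_edges_def)

lemma pl_edges_map_edges:
  assumes "pl_edges E" "inj_on f (\<Union>E)" "\<And>v. v \<in> \<Union>E \<Longrightarrow> f v \<noteq> Labeled 0"
  shows "pl_edges (map_edges f E)"
proof -
  have "card (f ` e) = 2" if "e \<in> E" for e
  proof -
    have "inj_on f e" using assms(2) that by (meson Union_upper inj_on_subset)
    then show ?thesis using assms(1) that by (simp add: card_image pl_edges_def)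
  qed
  moreover have "Labeled 0 \<notin> \<Union> (map_edges f E)"
    using assms(3) by (metis Union_map_edges imageE)
  ultimately show ?thesis using assms(1) by (auto simp: pl_edges_def map_edges_def)
qed

lemma pl_isoI:
  assumes "pl_edges E" "inj_on f (\<Union>E)" "\<And>v. v \<in> \<Union>E \<Longrightarrow> vlabel (f v) = vlabel v"
    "map_edges f E = E'"
  shows "pl_iso E E'"
proof -
  have "f v \<noteq> Labeled 0" if "v \<in> \<Union>E" for v
  proof
    assume "f v = Labeled 0"
    with assms(3)[OF that] have "vlabel v = Some 0" by simp
    then have "v = Labeled 0" by (cases v) auto
    with that assms(1) show False by (simp add: pl_edges_def)
  qed
  then have "pl_edges E'" using pl_edges_map_edges[OF assms(1,2)] assms(4) by simp
  then show ?thesis unfolding pl_iso_def bij_betw_def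
    using assms by (metis Union_map_edges)
qed

lemma pl_iso_refl: "pl_edges E \<Longrightarrow> pl_iso E E"
  by (rule pl_isoI[of _ "\<lambda>v. v"]) (auto simp: map_edges_id)

lemma pl_iso_sym: "pl_iso E E' \<Longrightarrow> pl_iso E' E"
proof -
  assume iso: "pl_iso E E'"
  then obtain p where p: "bij_betw p (\<Union>E) (\<Union>E')" "\<And>v. v \<in> \<Union>E \<Longrightarrow> vlabel (p v) = vlabel v"
    "map_edges p E = E'" unfolding pl_iso_def by blast
  let ?q = "inv_into (\<Union>E) p"
  have q: "?q (p v) = v" if "v \<in> \<Union>E" for v
    using p(1) that by (simp add: bij_betw_def)
  show ?thesis
  proof (rule pl_isoI[of _ ?q])
    show "pl_edges E'" using iso by (simp add: pl_iso_def)
    show "inj_on ?q (\<Union>E')" using p(1) by (metis bij_betw_def bij_betw_inv_into)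
    show "vlabel (?q v) = vlabel v" if vin: "v \<in> \<Union>E'" for v
    proof -
      obtain u where "u \<in> \<Union>E" "v = p u" using vin p(1) unfolding bij_betw_def by blast
      then show ?thesis using p(2) q by simp
    qed
    show "map_edges ?q E' = E"
      unfolding p(3)[symmetric] map_edges_comp by (rule map_edges_id) (rule q)
  qed
qed

lemma pl_iso_trans: "pl_iso A B \<Longrightarrow> pl_iso B C \<Longrightarrow> pl_iso A C"
proof -
  assume iso: "pl_iso A B" "pl_iso B C"
  obtain p where p: "bij_betw p (\<Union>A) (\<Union>B)" "\<And>v. v \<in> \<Union>A \<Longrightarrow> vlabel (p v) = vlabel v"
    "map_edges p A = B" using iso(1) unfolding pl_iso_def by blast
  obtain q where q: "bij_betw q (\<Union>B) (\<Union>C)" "\<And>v. v \<in> \<Union>B \<Longrightarrow> vlabel (q v) = vlabel v"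
    "map_edges q B = C" using iso(2) unfolding pl_iso_def by blast
  have pm: "p v \<in> \<Union>B" if "v \<in> \<Union>A" for v using p(1) that bij_betwE by blast
  show ?thesis
  proof (rule pl_isoI[of _ "\<lambda>v. q (p v)"])
    show "pl_edges A" using iso(1) by (simp add: pl_iso_def)
    show "inj_on (\<lambda>v. q (p v)) (\<Union>A)"
      using bij_betw_trans[OF p(1) q(1)] by (simp add: bij_betw_def comp_def)
    show "vlabel (q (p v)) = vlabel v" if "v \<in> \<Union>A" for v
      using p(2)[OF that] q(2)[OF pm[OF that]] by simp
    show "map_edges (\<lambda>v. q (p v)) A = C"
      using map_edges_comp[of q p A] p(3) q(3) by simp
  qed
qed

quotient_type pl_graph = "vertex set set" / partial: pl_iso
proof (rule part_equivpI)
  have "pl_edges {}" by (simp add: pl_edges_def)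
  then show "\<exists>E. pl_iso E E" using pl_iso_refl by blast
  show "symp pl_iso" by (rule sympI) (rule pl_iso_sym)
  show "transp pl_iso" by (rule transpI) (rule pl_iso_trans)
qed

lemma pl_iso_edges: "pl_iso E E' \<Longrightarrow> pl_edges E" "pl_iso E E' \<Longrightarrow> pl_edges E'"
  by (simp_all add: pl_iso_def)

lemma inj_rename: "inj g \<Longrightarrow> inj (rename g)"
proof (rule injI)
  fix v w assume "inj g" "rename g v = rename g w"
  then show "v = w" by (cases v; cases w) (auto dest: injD)
qed

lemma vlabel_rename [simp]: "vlabel (rename g v) = vlabel v"
  by (cases v) auto

lemma rename_eq_Labeled [simp]: "rename g v = Labeled l \<longleftrightarrow> v = Labeled l"
  by (cases v) auto

lemma rename_rename [simp]: "rename g (rename h v) = rename (\<lambda>i. g (h i)) v"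
  by (cases v) auto

lemma pl_edges_rename: "pl_edges E \<Longrightarrow> inj g \<Longrightarrow> pl_edges (map_edges (rename g) E)"
proof (rule pl_edges_map_edges)
  assume *: "pl_edges E" "inj g"
  show "inj_on (rename g) (\<Union>E)" using inj_rename[OF *(2)] inj_on_subset by blast
  show "rename g v \<noteq> Labeled 0" if "v \<in> \<Union>E" for v
    using * that by (auto simp: pl_edges_def)
qed

lemma pl_iso_rename: "pl_edges E \<Longrightarrow> inj g \<Longrightarrow> pl_iso E (map_edges (rename g) E)"
  by (rule pl_isoI[of _ "rename g"]) (simp_all add: inj_on_subset[OF inj_rename])

lemma pl_edges_glue: "pl_edges A \<Longrightarrow> pl_edges B \<Longrightarrow> pl_edges (glue_edges A B)"
proof -
  assume "pl_edges A" "pl_edges B"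
  then have "pl_edges (map_edges (rename (\<lambda>i. 2 * i)) A)"
    "pl_edges (map_edges (rename (\<lambda>i. 2 * i + 1)) B)"
    by (auto intro!: pl_edges_rename injI)
  then show ?thesis unfolding glue_edges_def pl_edges_def by auto
qed

lemma pl_iso_glue:
  assumes "pl_iso A A'" "pl_iso B B'"
  shows "pl_iso (glue_edges A B) (glue_edges A' B')"
proof -
  obtain p where p: "bij_betw p (\<Union>A) (\<Union>A')" "\<And>v. v \<in> \<Union>A \<Longrightarrow> vlabel (p v) = vlabel v"
    "map_edges p A = A'" using assms(1) unfolding pl_iso_def by blast
  obtain q where q: "bij_betw q (\<Union>B) (\<Union>B')" "\<And>v. v \<in> \<Union>B \<Longrightarrow> vlabel (q v) = vlabel v"
    "map_edges q B = B'" using assms(2) unfolding pl_iso_def by blast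
  have pinj: "v = w" if "p v = p w" "v \<in> \<Union>A" "w \<in> \<Union>A" for v w
    using p(1) that by (meson bij_betw_def inj_onD)
  have qinj: "v = w" if "q v = q w" "v \<in> \<Union>B" "w \<in> \<Union>B" for v w
    using q(1) that by (meson bij_betw_def inj_onD)
  let ?e = "rename (\<lambda>i. 2 * i)" and ?o = "rename (\<lambda>i. 2 * i + 1)"
  define f where "f v = (case v of Labeled l \<Rightarrow> Labeled l
      | Unlabeled i \<Rightarrow> if even i then ?e (p (Unlabeled (i div 2))) else ?o (q (Unlabeled (i div 2))))"
    for v
  have pL: "p (Labeled l) = Labeled l" if "Labeled l \<in> \<Union>A" for l
    using p(2)[OF that] by (cases "p (Labeled l)") auto
  have qL: "q (Labeled l) = Labeled l" if "Labeled l \<in> \<Union>B" for l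
    using q(2)[OF that] by (cases "q (Labeled l)") auto
  have pU: "\<exists>j. p (Unlabeled i) = Unlabeled j" if "Unlabeled i \<in> \<Union>A" for i
    using p(2)[OF that] by (cases "p (Unlabeled i)") auto
  have qU: "\<exists>j. q (Unlabeled i) = Unlabeled j" if "Unlabeled i \<in> \<Union>B" for i
    using q(2)[OF that] by (cases "q (Unlabeled i)") auto
  have fe: "f (?e v) = ?e (p v)" if "v \<in> \<Union>A" for v
    using that pL by (cases v) (auto simp: f_def)
  have fo: "f (?o v) = ?o (q v)" if "v \<in> \<Union>B" for v
    using that qL by (cases v) (auto simp: f_def)
  have verts: "\<Union> (glue_edges A B) = ?e ` \<Union>A \<union> ?o ` \<Union>B"
    unfolding glue_edges_def Union_Un_distrib Union_map_edges ..
  show ?thesis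
  proof (rule pl_isoI[of _ f])
    show "pl_edges (glue_edges A B)" using assms pl_iso_edges pl_edges_glue by blast
    show "map_edges f (glue_edges A B) = glue_edges A' B'"
    proof -
      have "map_edges f (glue_edges A B)
          = map_edges (\<lambda>v. f (?e v)) A \<union> map_edges (\<lambda>v. f (?o v)) B"
        unfolding glue_edges_def map_edges_Un map_edges_comp ..
      also have "\<dots> = map_edges (\<lambda>v. ?e (p v)) A \<union> map_edges (\<lambda>v. ?o (q v)) B"
        using map_edges_cong[of A "\<lambda>v. f (?e v)"] map_edges_cong[of B "\<lambda>v. f (?o v)"] fe fo
        by metis
      also have "\<dots> = map_edges ?e (map_edges p A) \<union> map_edges ?o (map_edges q B)"
        unfolding map_edges_comp ..
      finally show ?thesis unfolding p(3) q(3) glue_edges_def .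
    qed
    show "vlabel (f v) = vlabel v" if vin: "v \<in> \<Union> (glue_edges A B)" for v
    proof -
      consider w where "v = ?e w" "w \<in> \<Union>A" | w where "v = ?o w" "w \<in> \<Union>B"
        using vin unfolding verts by blast
      then show ?thesis
        by cases (metis fe p(2) vlabel_rename, metis fo q(2) vlabel_rename)
    qed
    have ee: "?e v = ?e w \<Longrightarrow> v = w" and oo: "?o v = ?o w \<Longrightarrow> v = w" for v w
      by (cases v; cases w; simp)+
    have eo: "x = ?o w" if *: "v \<in> \<Union>A" "w \<in> \<Union>B" "x = ?e v" "?e (p v) = ?o (q w)" for v w x
    proof (cases v)
      case (Labeled l)
      with * pL have "q w = Labeled l" by (metis rename.simps(1) rename_eq_Labeled)
      moreover have "w = Labeled l" using q(2)[OF *(2)] \<open>q w = Labeled l\<close> by (cases w) auto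
      ultimately show ?thesis using Labeled * by simp
    next
      case (Unlabeled i)
      then obtain j where j: "p v = Unlabeled j" using pU * by blast
      then show ?thesis using *(4) by (cases "q w") (auto, presburger)
    qed
    show "inj_on f (\<Union> (glue_edges A B))"
    proof (rule inj_onI)
      fix x y assume xy: "x \<in> \<Union> (glue_edges A B)" "y \<in> \<Union> (glue_edges A B)" "f x = f y"
      consider v w where "x = ?e v" "y = ?e w" "v \<in> \<Union>A" "w \<in> \<Union>A"
        | v w where "x = ?e v" "y = ?o w" "v \<in> \<Union>A" "w \<in> \<Union>B"
        | v w where "x = ?o v" "y = ?e w" "v \<in> \<Union>B" "w \<in> \<Union>A"
        | v w where "x = ?o v" "y = ?o w" "v \<in> \<Union>B" "w \<in> \<Union>B"
        using xy(1,2) unfolding verts by blast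
      then show "x = y"
      proof cases
        case 1 then show ?thesis using xy(3) fe ee pinj by metis
      next
        case 2 then show ?thesis using xy(3) fe fo eo by metis
      next
        case 3 then show ?thesis using xy(3) fe fo eo by metis
      next
        case 4 then show ?thesis using xy(3) fo oo qinj by metis
      qed
    qed
  qed
qed

lemma pl_iso_glue_assoc:
  assumes "pl_edges A" "pl_edges B" "pl_edges C"
  shows "pl_iso (glue_edges (glue_edges A B) C) (glue_edges A (glue_edges B C))"
proof -
  define h :: "nat \<Rightarrow> nat" where
    "h n = (if n mod 4 = 0 then n div 2 else if n mod 4 = 2 then n - 1 else 2 * n + 1)" for n
  have h: "h (2 * (2 * i)) = 2 * i" "h (2 * (2 * i + 1)) = 2 * (2 * i) + 1"
    "h (2 * i + 1) = 2 * (2 * i + 1) + 1" for i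
  proof -
    have "(2 * (2 * i)) mod 4 = 0" "(2 * (2 * i + 1)) mod 4 = 2" "odd (2 * i + 1)"
      by presburger+
    moreover have "n mod 4 \<noteq> 0 \<and> n mod 4 \<noteq> 2" if "odd n" for n :: nat
      using that by presburger
    ultimately show "h (2 * (2 * i)) = 2 * i" "h (2 * (2 * i + 1)) = 2 * (2 * i) + 1"
      "h (2 * i + 1) = 2 * (2 * i + 1) + 1"
      unfolding h_def by simp_all
  qed
  have "inj h"
  proof (rule injI)
    fix m n assume "h m = h n"
    have ex: "\<exists>i. n = 2 * (2 * i) \<or> n = 2 * (2 * i + 1) \<or> n = 2 * i + 1" for n :: nat
      by presburger
    from ex[of m] ex[of n] obtain i j
      where "m = 2 * (2 * i) \<or> m = 2 * (2 * i + 1) \<or> m = 2 * i + 1"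
        "n = 2 * (2 * j) \<or> n = 2 * (2 * j + 1) \<or> n = 2 * j + 1" by blast
    with \<open>h m = h n\<close> show "m = n" by (elim disjE) (simp_all only: h, presburger+)
  qed
  then have "pl_iso (glue_edges (glue_edges A B) C)
      (map_edges (rename h) (glue_edges (glue_edges A B) C))"
    using assms by (intro pl_iso_rename pl_edges_glue)
  also have "map_edges (rename h) (glue_edges (glue_edges A B) C) = glue_edges A (glue_edges B C)"
    unfolding glue_edges_def map_edges_Un map_edges_comp rename_rename h by (simp add: Un_assoc)
  finally show ?thesis .
qed

lemma pl_iso_glue_commute:
  assumes "pl_edges A" "pl_edges B"
  shows "pl_iso (glue_edges A B) (glue_edges B A)"
proof -
  define h :: "nat \<Rightarrow> nat" where "h n = (if even n then n + 1 else n - 1)" for n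
  have h: "h (2 * i) = 2 * i + 1" "h (2 * i + 1) = 2 * i" for i
    unfolding h_def by simp_all
  have "inj h" by (rule injI) (unfold h_def, presburger)
  then have "pl_iso (glue_edges A B) (map_edges (rename h) (glue_edges A B))"
    using assms by (intro pl_iso_rename pl_edges_glue)
  also have "map_edges (rename h) (glue_edges A B) = glue_edges B A"
    unfolding glue_edges_def map_edges_Un map_edges_comp rename_rename h by (simp add: Un_commute)
  finally show ?thesis .
qed

lemma pl_iso_glue_empty:
  assumes "pl_edges B"
  shows "pl_iso (glue_edges {} B) B"
  using pl_iso_sym[OF pl_iso_rename[OF assms, of "\<lambda>i. 2 * i + 1"]]
  by (simp add: glue_edges_def inj_def) (simp add: map_edges_def)

text \<open>
  The product of partially labeled graphs is written additively, so that \<open>pl_graph \<Rightarrow>\<^sub>0 real\<close>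
  becomes the monoid algebra of this product: \<open>single H 1 * single K 1 = single (H + K) 1\<close>.
\<close>

instantiation pl_graph :: comm_monoid_add
begin

lift_definition zero_pl_graph :: pl_graph is "{}"
  by (rule pl_iso_refl) (simp add: pl_edges_def)

lift_definition plus_pl_graph :: "pl_graph \<Rightarrow> pl_graph \<Rightarrow> pl_graph" is glue_edges
  by (rule pl_iso_glue)

instance
proof
  fix A B C :: pl_graph
  show "A + B + C = A + (B + C)"
    by transfer (rule pl_iso_glue_assoc; blast dest: pl_iso_edges)
  show "A + B = B + A"
    by transfer (rule pl_iso_glue_commute; blast dest: pl_iso_edges)
  show "0 + A = A"
    by transfer (rule pl_iso_glue_empty; blast dest: pl_iso_edges)
qed

end

lift_definition degree :: "pl_graph \<Rightarrow> nat" is card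
proof -
  fix E E' assume "pl_iso E E'"
  then obtain p where p: "bij_betw p (\<Union>E) (\<Union>E')" "map_edges p E = E'"
    unfolding pl_iso_def by blast
  then have "inj_on (\<lambda>e. p ` e) E" by (meson bij_betw_def inj_on_image)
  then show "card E = card E'" using p(2) card_image unfolding map_edges_def by fastforce
qed

lift_definition unlabeled :: "pl_graph \<Rightarrow> bool" is "\<lambda>E. \<forall>v\<in>\<Union>E. vlabel v = None"
  unfolding pl_iso_def bij_betw_def by (metis imageE imageI)

lift_definition fully_labeled :: "pl_graph \<Rightarrow> bool" is "\<lambda>E. \<forall>v\<in>\<Union>E. vlabel v \<noteq> None"
  unfolding pl_iso_def bij_betw_def by (metis imageE imageI)

lemma inj_forget: "inj forget"
proof (rule injI)
  fix v w assume "forget v = forget w"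
  then show "v = w" by (cases v; cases w; simp) presburger+
qed

lemma vlabel_forget: "vlabel (forget v) = None"
  by (cases v) auto

lift_definition erase_labels :: "pl_graph \<Rightarrow> pl_graph" is "map_edges forget"
proof -
  fix E E' assume iso: "pl_iso E E'"
  then obtain p where p: "bij_betw p (\<Union>E) (\<Union>E')" "map_edges p E = E'"
    unfolding pl_iso_def by blast
  have E: "pl_edges (map_edges forget E)"
  proof (rule pl_edges_map_edges)
    show "pl_edges E" using iso pl_iso_edges by blast
    show "inj_on forget (\<Union>E)" using inj_forget inj_on_subset by blast
    show "forget v \<noteq> Labeled 0" for v by (cases v) auto
  qed
  show "pl_iso (map_edges forget E) (map_edges forget E')"
  proof (rule pl_isoI[OF E, of "\<lambda>v. forget (p (inv forget v))"])
    have "inj_on (\<lambda>v. p (inv forget v)) (forget ` \<Union>E)"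
    proof (rule inj_onI)
      fix x y assume x: "x \<in> forget ` \<Union>E" and y: "y \<in> forget ` \<Union>E"
        and eq: "p (inv forget x) = p (inv forget y)"
      obtain v where v: "x = forget v" "v \<in> \<Union>E" using x by (rule imageE)
      obtain w where w: "y = forget w" "w \<in> \<Union>E" using y by (rule imageE)
      have "p v = p w" using eq unfolding v(1) w(1) inv_f_f[OF inj_forget] .
      then have "v = w" by (rule inj_onD[OF bij_betw_imp_inj_on[OF p(1)] _ v(2) w(2)])
      then show "x = y" using v w by simp
    qed
    then show "inj_on (\<lambda>v. forget (p (inv forget v))) (\<Union> (map_edges forget E))"
      unfolding Union_map_edges inj_on_def by (simp only: inj_eq[OF inj_forget])
    show "vlabel (forget (p (inv forget v))) = vlabel v"
      if "v \<in> \<Union> (map_edges forget E)" for v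
      using that unfolding Union_map_edges by (auto simp: vlabel_forget)
    show "map_edges (\<lambda>v. forget (p (inv forget v))) (map_edges forget E) = map_edges forget E'"
      unfolding map_edges_comp p(2)[symmetric] inv_f_f[OF inj_forget] ..
  qed
qed

type_synonym graph_comb = "pl_graph \<Rightarrow>\<^sub>0 real"

definition unlabeled_combs :: "graph_comb set" where
  "unlabeled_combs = {f. \<forall>F\<in>Poly_Mapping.keys f. unlabeled F}"

definition unlabel :: "graph_comb \<Rightarrow> graph_comb" where
  "unlabel a = (\<Sum>H\<in>Poly_Mapping.keys a.
     Poly_Mapping.single (erase_labels H) (Poly_Mapping.lookup a H))"

lemma unlabel_single: "unlabel (Poly_Mapping.single H c) = Poly_Mapping.single (erase_labels H) c"
  by (cases "c = 0") (simp_all add: unlabel_def)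

lemma unlabel_superset:
  "finite S \<Longrightarrow> Poly_Mapping.keys a \<subseteq> S \<Longrightarrow>
    unlabel a = (\<Sum>H\<in>S. Poly_Mapping.single (erase_labels H) (Poly_Mapping.lookup a H))"
  unfolding unlabel_def by (rule sum.mono_neutral_left) (auto simp: in_keys_iff)

lemma unlabel_add: "unlabel (a + b) = unlabel a + unlabel b"
proof -
  let ?S = "Poly_Mapping.keys a \<union> Poly_Mapping.keys b"
  have *: "finite ?S" by simp
  show ?thesis
    using Poly_Mapping.keys_add[of a b]
    by (simp add: unlabel_superset[OF *] lookup_add single_add sum.distrib)
qed

definition is_sos :: "graph_comb \<Rightarrow> bool" where
  "is_sos f \<longleftrightarrow> f \<in> unlabeled_combs \<and>
     (\<exists>(n::nat) (a :: nat \<Rightarrow> graph_comb). f = (\<Sum>i<n. unlabel ((a i)\<^sup>2)))"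

definition trivial_square :: "pl_graph \<Rightarrow> bool" where
  "trivial_square F \<longleftrightarrow> unlabeled F \<and>
     (\<forall>H. Poly_Mapping.single F 1 = unlabel ((Poly_Mapping.single H 1)\<^sup>2) \<longrightarrow>
        fully_labeled H \<and> erase_labels H = F)"

end

theory Submission
  imports Defs "HOL-Library.FuncSet"
begin

text \<open>
  Gluing satisfies \<open>2 deg (HK) \<ge> deg (H\<^sup>2) + deg (K\<^sup>2)\<close>, with equality only if \<open>H\<close> and \<open>K\<close> have the
  same edges between labeled vertices. Suppose \<open>f\<close> is the sum of the \<open>[[a\<^sub>i\<^sup>2]]\<close>, and let \<open>d\<close> be the least
  degree of any \<open>H\<^sup>2\<close> with \<open>H\<close> occurring in some \<open>a\<^sub>i\<close>. Terms of degree \<open>d\<close> arise only from pairs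
  whose squares also have degree \<open>d\<close>, and a fully labeled \<open>H\<close> pairs only with itself. If all \<open>H\<close>
  with \<open>deg (H\<^sup>2) = d\<close> are fully labeled, all coefficients in degree \<open>d\<close> are therefore sums of
  squares, which contradicts (1).

  Otherwise let \<open>\<Phi>\<close> be the sum over all target graphs on a large vertex set of the homomorphism
  density. As in Lovasz's theorem that homomorphism counts determine a graph,
  \<open>2 \<Phi>(HK) < \<Phi>(H\<^sup>2) + \<Phi>(K\<^sup>2)\<close> for \<open>H \<noteq> K\<close>. Among the \<open>H\<close> that are not fully labeled and have
  \<open>deg (H\<^sup>2) = d\<close>, take one that maximises \<open>\<Phi>(H\<^sup>2)\<close>: then \<open>[[H\<^sup>2]]\<close> is not \<open>[[K\<^sub>1 K\<^sub>2]]\<close> for any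
  \<open>K\<^sub>1 \<noteq> K\<^sub>2\<close> occurring together, so its coefficient in \<open>f\<close> is positive, which contradicts (2).
\<close>

section \<open>Homomorphism densities with prescribed labels\<close>

lemma sum_PiE_Un:
  assumes "W \<inter> W' = {}"
  shows "(\<Sum>\<alpha>\<in>(W \<union> W') \<rightarrow>\<^sub>E X. f \<alpha>) =
    (\<Sum>\<beta>\<in>W \<rightarrow>\<^sub>E X. \<Sum>\<gamma>\<in>W' \<rightarrow>\<^sub>E X. f (override_on \<gamma> \<beta> W))"
  unfolding sum.cartesian_product
proof (rule sum.reindex_bij_witness[of _ "\<lambda>(\<beta>, \<gamma>). override_on \<gamma> \<beta> W"
      "\<lambda>\<alpha>. (restrict \<alpha> W, restrict \<alpha> W')"])
  fix \<alpha> assume \<alpha>: "\<alpha> \<in> (W \<union> W') \<rightarrow>\<^sub>E X"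
  then have *: "override_on (restrict \<alpha> W') (restrict \<alpha> W) W = \<alpha>"
    by (auto simp: fun_eq_iff override_on_def PiE_def extensional_def)
  then show "(case (restrict \<alpha> W, restrict \<alpha> W') of (\<beta>, \<gamma>) \<Rightarrow> override_on \<gamma> \<beta> W) = \<alpha>"
    and "(case (restrict \<alpha> W, restrict \<alpha> W') of (\<beta>, \<gamma>) \<Rightarrow> f (override_on \<gamma> \<beta> W)) = f \<alpha>"
    by simp_all
  show "(restrict \<alpha> W, restrict \<alpha> W') \<in> (W \<rightarrow>\<^sub>E X) \<times> (W' \<rightarrow>\<^sub>E X)"
    using \<alpha> by auto
next
  fix x assume "x \<in> (W \<rightarrow>\<^sub>E X) \<times> (W' \<rightarrow>\<^sub>E X)"
  then obtain \<beta> \<gamma> where x: "x = (\<beta>, \<gamma>)" "\<beta> \<in> W \<rightarrow>\<^sub>E X" "\<gamma> \<in> W' \<rightarrow>\<^sub>E X" by blast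
  show "(\<lambda>\<alpha>. (restrict \<alpha> W, restrict \<alpha> W')) (case x of (\<beta>, \<gamma>) \<Rightarrow> override_on \<gamma> \<beta> W) = x"
    using x assms
    by (auto simp: fun_eq_iff override_on_def PiE_def extensional_def restrict_def)
  show "(case x of (\<beta>, \<gamma>) \<Rightarrow> override_on \<gamma> \<beta> W) \<in> (W \<union> W') \<rightarrow>\<^sub>E X"
    using x by (auto simp: override_on_def PiE_iff extensional_def)
qed

text \<open>
  The probability that a uniformly random map into \<open>X\<close>, prescribed to be \<open>\<phi>\<close> on \<open>S\<close>, sends all
  edges of \<open>E\<close> into \<open>G\<close>. The elements of \<open>G\<close> may be arbitrary subsets of \<open>X\<close>.
\<close>

definition hom_density ::
  "vertex set \<Rightarrow> (vertex \<Rightarrow> vertex) \<Rightarrow> vertex set \<Rightarrow> vertex set set \<Rightarrow> vertex set set \<Rightarrow> real" where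
  "hom_density S \<phi> X G E =
     (\<Sum>\<alpha>\<in>(\<Union>E - S) \<rightarrow>\<^sub>E X. of_bool (map_edges (override_on \<alpha> \<phi> S) E \<subseteq> G))
       / real (card X) ^ card (\<Union>E - S)"

text \<open>Values on vertices that \<open>E\<close> does not see are free: each map on
  \<open>\<Union>E - S\<close> has the same number of extensions to \<open>V\<close>, and the
  normalisation cancels it. So densities of different graphs can be averaged over one common vertex
  set.\<close>

lemma hom_density_pad:
  assumes "finite V" "\<Union>E - S \<subseteq> V" "finite X" "X \<noteq> {}"
  shows "hom_density S \<phi> X G E =
    (\<Sum>\<alpha>\<in>V \<rightarrow>\<^sub>E X. of_bool (map_edges (override_on \<alpha> \<phi> S) E \<subseteq> G)) / real (card X) ^ card V"
proof -
  define W where "W = \<Union>E - S"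
  have V: "V = W \<union> (V - W)" "finite W" using assms(1,2) finite_subset by (auto simp: W_def)
  have "card V = card W + card (V - W)"
    by (subst V(1), rule card_Un_disjoint) (use V(2) assms(1) in auto)
  moreover have "(\<Sum>\<alpha>\<in>V \<rightarrow>\<^sub>E X. of_bool (map_edges (override_on \<alpha> \<phi> S) E \<subseteq> G) :: real)
     = (\<Sum>\<beta>\<in>W \<rightarrow>\<^sub>E X. \<Sum>\<gamma>\<in>(V - W) \<rightarrow>\<^sub>E X.
          of_bool (map_edges (override_on (override_on \<gamma> \<beta> W) \<phi> S) E \<subseteq> G))"
    by (subst V(1), rule sum_PiE_Un) blast
  moreover have "map_edges (override_on (override_on \<gamma> \<beta> W) \<phi> S) E
      = map_edges (override_on \<beta> \<phi> S) E" for \<beta> \<gamma>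
    by (rule map_edges_cong) (auto simp: override_on_def W_def)
  ultimately show ?thesis
    using assms V(2) unfolding hom_density_def W_def[symmetric]
    by (simp add: card_PiE power_add sum_distrib_left[symmetric] field_simps)
qed

text \<open>Precomposition with \<open>p\<close> is a bijection between the maps on the free
  vertices. Used with labels in \<open>S\<close> to undo the renaming in a product, and with
  \<open>S\<close> empty for arbitrary injections, which may then change labels.\<close>

lemma hom_density_map_edges:
  assumes inj: "inj_on p (\<Union>E)" and fixed: "\<And>v. v \<in> \<Union>E \<Longrightarrow> v \<in> S \<Longrightarrow> p v = v"
    and out: "\<And>v. v \<in> \<Union>E \<Longrightarrow> v \<notin> S \<Longrightarrow> p v \<notin> S"
  shows "hom_density S \<phi> X G (map_edges p E) = hom_density S \<phi> X G E"
proof -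
  define W where "W = \<Union>E - S"
  have injW: "inj_on p W" using inj by (rule inj_on_subset) (auto simp: W_def)
  have verts: "\<Union> (map_edges p E) - S = p ` W"
    unfolding Union_map_edges W_def
  proof (intro equalityI subsetI)
    fix x assume "x \<in> p ` \<Union>E - S"
    then obtain v where v: "v \<in> \<Union>E" "x = p v" "x \<notin> S" by blast
    then have "v \<notin> S" using fixed by metis
    then show "x \<in> p ` (\<Union>E - S)" using v by blast
  next
    fix x assume "x \<in> p ` (\<Union>E - S)"
    then show "x \<in> p ` \<Union>E - S" using out by blast
  qed
  have "(\<Sum>\<alpha>\<in>p ` W \<rightarrow>\<^sub>E X. of_bool (map_edges (override_on \<alpha> \<phi> S) (map_edges p E) \<subseteq> G) :: real)
    = (\<Sum>\<alpha>\<in>W \<rightarrow>\<^sub>E X. of_bool (map_edges (override_on \<alpha> \<phi> S) E \<subseteq> G))"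
  proof (rule sum.reindex_bij_witness[of _ "\<lambda>\<alpha>. \<lambda>w\<in>p ` W. \<alpha> (inv_into W p w)"
        "\<lambda>\<alpha>. \<lambda>v\<in>W. \<alpha> (p v)"])
    fix \<alpha> assume \<alpha>: "\<alpha> \<in> p ` W \<rightarrow>\<^sub>E X"
    show "(\<lambda>w\<in>p ` W. (\<lambda>v\<in>W. \<alpha> (p v)) (inv_into W p w)) = \<alpha>"
      using \<alpha> by (auto simp: fun_eq_iff PiE_def extensional_def restrict_def injW)
    show "(\<lambda>v\<in>W. \<alpha> (p v)) \<in> W \<rightarrow>\<^sub>E X" using \<alpha> by auto
    have "map_edges (override_on (\<lambda>v\<in>W. \<alpha> (p v)) \<phi> S) E
        = map_edges (\<lambda>v. override_on \<alpha> \<phi> S (p v)) E"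
    proof (rule map_edges_cong)
      fix v assume "v \<in> \<Union>E"
      then show "override_on (\<lambda>v\<in>W. \<alpha> (p v)) \<phi> S v = override_on \<alpha> \<phi> S (p v)"
        using fixed[of v] out[of v] by (cases "v \<in> S") (simp_all add: override_on_def W_def)
    qed
    then show "(of_bool (map_edges (override_on (\<lambda>v\<in>W. \<alpha> (p v)) \<phi> S) E \<subseteq> G) :: real)
        = of_bool (map_edges (override_on \<alpha> \<phi> S) (map_edges p E) \<subseteq> G)"
      by (simp add: map_edges_comp)
  next
    fix \<beta> assume \<beta>: "\<beta> \<in> W \<rightarrow>\<^sub>E X"
    show "(\<lambda>v\<in>W. (\<lambda>w\<in>p ` W. \<beta> (inv_into W p w)) (p v)) = \<beta>"
      using \<beta> by (auto simp: fun_eq_iff PiE_def extensional_def restrict_def injW)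
    show "(\<lambda>w\<in>p ` W. \<beta> (inv_into W p w)) \<in> p ` W \<rightarrow>\<^sub>E X"
      using \<beta> by (auto simp: injW)
  qed
  then show ?thesis
    unfolding hom_density_def verts card_image[OF injW] W_def[symmetric] by simp
qed

text \<open>Conditional independence: once the images of \<open>S\<close> are fixed, the free
  vertices of \<open>A\<close> and of \<open>B\<close> are disjoint, so the two containment events
  are independent. The function \<open>\<psi>\<close> is a dummy, since overriding on the empty set
  ignores it.\<close>

lemma hom_density_Un:
  assumes "finite S" "finite (\<Union>A)" "finite (\<Union>B)" "finite X" "X \<noteq> {}" "\<Union>A \<inter> \<Union>B \<subseteq> S"
  shows "hom_density {} \<psi> X G (A \<union> B) =
    (\<Sum>\<phi>\<in>S \<rightarrow>\<^sub>E X. hom_density S \<phi> X G A * hom_density S \<phi> X G B) / real (card X) ^ card S"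
proof -
  define P Q where "P = \<Union>A - S" and "Q = \<Union>B - S"
  have fin: "finite P" "finite Q" using assms by (auto simp: P_def Q_def)
  have dis: "P \<inter> Q = {}" "S \<inter> (P \<union> Q) = {}" using assms(6) by (auto simp: P_def Q_def)
  have cd: "card (S \<union> (P \<union> Q)) = card S + (card P + card Q)"
    using fin dis assms(1) by (simp add: card_Un_disjoint)
  have split: "(of_bool (map_edges (override_on (override_on (override_on \<beta> \<alpha> P) \<phi> S) \<psi> {})
        (A \<union> B) \<subseteq> G) :: real)
    = of_bool (map_edges (override_on \<alpha> \<phi> S) A \<subseteq> G) *
      of_bool (map_edges (override_on \<beta> \<phi> S) B \<subseteq> G)"
    for \<alpha> \<beta> \<phi>
  proof -
    have "map_edges (override_on (override_on \<beta> \<alpha> P) \<phi> S) A = map_edges (override_on \<alpha> \<phi> S) A"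
      by (rule map_edges_cong) (auto simp: override_on_def P_def)
    moreover have "map_edges (override_on (override_on \<beta> \<alpha> P) \<phi> S) B = map_edges (override_on \<beta> \<phi> S) B"
      using assms(6) by (intro map_edges_cong) (auto simp: override_on_def P_def)
    ultimately show ?thesis by (simp add: map_edges_Un)
  qed
  have "hom_density {} \<psi> X G (A \<union> B) =
    (\<Sum>\<alpha>\<in>S \<union> (P \<union> Q) \<rightarrow>\<^sub>E X. of_bool (map_edges (override_on \<alpha> \<psi> {}) (A \<union> B) \<subseteq> G))
      / real (card X) ^ card (S \<union> (P \<union> Q))"
    using fin assms by (intro hom_density_pad) (auto simp: P_def Q_def)
  also have "\<dots> = (\<Sum>\<phi>\<in>S \<rightarrow>\<^sub>E X. \<Sum>\<alpha>\<in>P \<rightarrow>\<^sub>E X. \<Sum>\<beta>\<in>Q \<rightarrow>\<^sub>E X.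
      of_bool (map_edges (override_on \<alpha> \<phi> S) A \<subseteq> G) * of_bool (map_edges (override_on \<beta> \<phi> S) B \<subseteq> G))
      / real (card X) ^ (card S + (card P + card Q))"
    unfolding sum_PiE_Un[OF dis(2)] sum_PiE_Un[OF dis(1)] split cd ..
  also have "\<dots> = (\<Sum>\<phi>\<in>S \<rightarrow>\<^sub>E X. hom_density S \<phi> X G A * hom_density S \<phi> X G B)
      / real (card X) ^ card S"
    unfolding hom_density_def P_def[symmetric] Q_def[symmetric]
    by (simp add: sum_product power_add sum_divide_distrib[symmetric] field_simps)
  finally show ?thesis .
qed

lemma finite_verts: "pl_edges E \<Longrightarrow> finite (\<Union>E)"
  unfolding pl_edges_def by (intro finite_Union) (auto intro: card_ge_0_finite)

text \<open>\<open>S\<close> may contain labels that neither factor uses. This lets the products of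
  \<open>A\<close> with \<open>A\<close>, \<open>A\<close> with \<open>B\<close> and
  \<open>B\<close> with \<open>B\<close> be averaged over the same maps \<open>\<phi>\<close>, as is
  needed to complete the square.\<close>

lemma hom_density_glue:
  assumes "pl_edges A" "pl_edges B" "finite X" "X \<noteq> {}" "finite S"
    and S: "\<And>v. v \<in> \<Union>A \<union> \<Union>B \<Longrightarrow> v \<in> S \<longleftrightarrow> vlabel v \<noteq> None" "S \<subseteq> range Labeled"
  shows "hom_density {} \<psi> X G (glue_edges A B) =
    (\<Sum>\<phi>\<in>S \<rightarrow>\<^sub>E X. hom_density S \<phi> X G A * hom_density S \<phi> X G B) / real (card X) ^ card S"
proof -
  let ?e = "rename (\<lambda>i. 2 * i)" and ?o = "rename (\<lambda>i. 2 * i + 1)"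
  have ren: "hom_density S \<phi> X G (map_edges (rename g) E) = hom_density S \<phi> X G E"
    if g: "inj g" and E: "\<Union>E \<subseteq> \<Union>A \<union> \<Union>B" for g E \<phi>
  proof (rule hom_density_map_edges)
    show "inj_on (rename g) (\<Union>E)" using inj_rename[OF g] inj_on_subset by blast
    show "rename g v = v" if "v \<in> \<Union>E" "v \<in> S" for v using that S(2) by auto
    show "rename g v \<notin> S" if "v \<in> \<Union>E" "v \<notin> S" for v
    proof
      assume "rename g v \<in> S"
      then obtain l where "rename g v = Labeled l" using S(2) by blast
      then have "v = Labeled l" by simp
      moreover have "v \<in> \<Union>A \<union> \<Union>B" using that(1) E by blast
      ultimately show False using S(1)[of v] that(2) by simp
    qed
  qed
  have "?e ` \<Union>A \<inter> ?o ` \<Union>B \<subseteq> S"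
  proof
    fix x assume "x \<in> ?e ` \<Union>A \<inter> ?o ` \<Union>B"
    then obtain v w where vw: "v \<in> \<Union>A" "w \<in> \<Union>B" "x = ?e v" "x = ?o w" by blast
    \<comment> \<open>Unlabeled vertices get even indices on one side and odd ones on the other, so
      only a label can be shared.\<close>
    then have "vlabel v \<noteq> None" by (cases v; cases w) (auto, presburger)
    then show "x \<in> S" using S(1)[of v] vw by (cases v) auto
  qed
  then have "hom_density {} \<psi> X G (glue_edges A B) = (\<Sum>\<phi>\<in>S \<rightarrow>\<^sub>E X.
      hom_density S \<phi> X G (map_edges ?e A) * hom_density S \<phi> X G (map_edges ?o B)) / real (card X) ^ card S"
    unfolding glue_edges_def using assms finite_verts
    by (intro hom_density_Un) (auto simp: Union_map_edges)
  then show ?thesis by (simp add: ren inj_def)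
qed

section \<open>Recovering a graph from its densities\<close>

text \<open>Moebius inversion in \<open>G\<close>: containment probabilities determine those of the exact image.\<close>

lemma exact_density_eq_of_hom_density_eq:
  assumes fin: "finite G"
    and eq: "\<And>G'. G' \<subseteq> G \<Longrightarrow> hom_density S \<phi> X G' A = hom_density S \<phi> X G' B"
  shows "(\<Sum>\<alpha>\<in>(\<Union>A - S) \<rightarrow>\<^sub>E X. of_bool (map_edges (override_on \<alpha> \<phi> S) A = G))
       / real (card X) ^ card (\<Union>A - S) =
    (\<Sum>\<alpha>\<in>(\<Union>B - S) \<rightarrow>\<^sub>E X. of_bool (map_edges (override_on \<alpha> \<phi> S) B = G))
       / real (card X) ^ card (\<Union>B - S)"
proof -
  define ex where "ex E G = (\<Sum>\<alpha>\<in>(\<Union>E - S) \<rightarrow>\<^sub>E X. of_bool (map_edges (override_on \<alpha> \<phi> S) E = G))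
       / real (card X) ^ card (\<Union>E - S)" for E G
  have exact: "hom_density S \<phi> X G E = (\<Sum>G'\<in>Pow G. ex E G')" if "finite G" for E G
  proof -
    have "(of_bool (M \<subseteq> G) :: real) = (\<Sum>G'\<in>Pow G. of_bool (M = G'))" for M
      using that by (simp add: of_bool_def)
    then show ?thesis
      unfolding hom_density_def ex_def sum_divide_distrib[symmetric]
      by (subst sum.swap) simp
  qed
  have "ex A G = ex B G" using fin eq
  proof (induction G rule: finite_psubset_induct)
    case (psubset G)
    have "(\<Sum>G'\<in>Pow G. ex A G') = (\<Sum>G'\<in>Pow G. ex B G')"
      using psubset.prems[of G] psubset.hyps by (simp add: exact)
    moreover have "(\<Sum>G'\<in>Pow G - {G}. ex A G') = (\<Sum>G'\<in>Pow G - {G}. ex B G')"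
    proof (rule sum.cong[OF refl])
      fix G' assume "G' \<in> Pow G - {G}"
      then have "G' \<subset> G" by blast
      then show "ex A G' = ex B G'" by (rule psubset.IH) (use \<open>G' \<subset> G\<close> psubset.prems in blast)
    qed
    ultimately show ?case
      using psubset.hyps sum.remove[of "Pow G" G "ex A"] sum.remove[of "Pow G" G "ex B"] by simp
  qed
  then show ?thesis by (simp add: ex_def)
qed

text \<open>The identity maps \<open>A\<close> exactly onto \<open>A\<close>, so the density of
  exact image \<open>A\<close> is positive for \<open>A\<close> and therefore for \<open>B\<close>.
  Prescribing the identity on \<open>S\<close> makes the resulting map fix \<open>S\<close>.\<close>

lemma surj_of_hom_density_eq:
  assumes A: "finite (\<Union>A)" "\<Union>A \<subseteq> X" and X: "finite X" "X \<noteq> {}"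
    and eq: "\<And>G. G \<subseteq> Pow X \<Longrightarrow> hom_density S (restrict id S) X G A = hom_density S (restrict id S) X G B"
  obtains \<sigma> where "map_edges \<sigma> B = A" "\<And>v. v \<in> S \<Longrightarrow> \<sigma> v = v"
proof -
  let ?\<phi> = "restrict id S"
  have fin: "finite (\<Union>E - S \<rightarrow>\<^sub>E X)" if "finite (\<Union>E)" for E
    using that X by (simp add: finite_PiE)
  have AP: "A \<subseteq> Pow X" using A by blast
  let ?\<iota> = "restrict id (\<Union>A - S)"
  have "?\<iota> \<in> \<Union>A - S \<rightarrow>\<^sub>E X" using A by auto
  moreover have "map_edges (override_on ?\<iota> ?\<phi> S) A = A"
    by (rule map_edges_id) (auto simp: override_on_def)
  ultimately have "0 < (\<Sum>\<alpha>\<in>\<Union>A - S \<rightarrow>\<^sub>E X. of_bool (map_edges (override_on \<alpha> ?\<phi> S) A = A) :: real)"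
    by (intro sum_pos2[OF fin[OF A(1)]]) auto
  moreover have "0 < real (card X)" using X by (simp add: card_gt_0_iff)
  ultimately have "0 < (\<Sum>\<alpha>\<in>\<Union>A - S \<rightarrow>\<^sub>E X. of_bool (map_edges (override_on \<alpha> ?\<phi> S) A = A))
       / real (card X) ^ card (\<Union>A - S)" by simp
  also have "\<dots> = (\<Sum>\<alpha>\<in>(\<Union>B - S) \<rightarrow>\<^sub>E X. of_bool (map_edges (override_on \<alpha> ?\<phi> S) B = A))
       / real (card X) ^ card (\<Union>B - S)"
    using X eq AP by (intro exact_density_eq_of_hom_density_eq) (auto intro: finite_subset[OF AP])
  finally have "(\<Sum>\<alpha>\<in>(\<Union>B - S) \<rightarrow>\<^sub>E X. of_bool (map_edges (override_on \<alpha> ?\<phi> S) B = A) :: real) \<noteq> 0"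
    by force
  then obtain \<alpha> where "map_edges (override_on \<alpha> ?\<phi> S) B = A"
    by (rule sum.not_neutral_contains_not_neutral) (auto split: if_splits simp: of_bool_def)
  then show thesis by (rule that) (simp add: override_on_def)
qed

text \<open>Finite vertex sets that map onto each other have equal size, so both surjections are
  injective. What remains is that no unlabeled vertex is sent to a labeled one.\<close>

lemma pl_iso_of_surj:
  assumes A: "pl_edges A" and B: "pl_edges B"
    and \<sigma>: "map_edges \<sigma> B = A" "\<And>v. v \<in> \<Union>A \<union> \<Union>B \<Longrightarrow> vlabel v \<noteq> None \<Longrightarrow> \<sigma> v = v"
    and \<tau>: "map_edges \<tau> A = B" "\<And>v. v \<in> \<Union>A \<union> \<Union>B \<Longrightarrow> vlabel v \<noteq> None \<Longrightarrow> \<tau> v = v"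
  shows "pl_iso B A"
proof -
  have \<sigma>V: "\<sigma> ` \<Union>B = \<Union>A" and \<tau>V: "\<tau> ` \<Union>A = \<Union>B"
    using \<sigma>(1) \<tau>(1) Union_map_edges by metis+
  have fin: "finite (\<Union>A)" "finite (\<Union>B)" using A B finite_verts by auto
  have "card (\<sigma> ` \<Union>B) = card (\<Union>B)"
    using card_image_le[OF fin(1), of \<tau>] card_image_le[OF fin(2), of \<sigma>] \<sigma>V \<tau>V by simp
  then have inj: "inj_on \<sigma> (\<Union>B)" using fin by (simp add: inj_on_iff_eq_card)
  show ?thesis
  proof (rule pl_isoI[OF B inj _ \<sigma>(1)])
    fix v assume v: "v \<in> \<Union>B"
    show "vlabel (\<sigma> v) = vlabel v"
    proof (cases "vlabel v = None")
      case False then show ?thesis using \<sigma>(2)[of v] v by simp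
    next
      case True
      \<comment> \<open>A labeled image would be fixed by \<open>\<tau>\<close>, hence lie in
        \<open>B\<close> too and be fixed by \<open>\<sigma>\<close>; injectivity would then
        identify it with the unlabeled \<open>v\<close>.\<close>
      have "vlabel (\<sigma> v) = None"
      proof (rule ccontr)
        assume l: "vlabel (\<sigma> v) \<noteq> None"
        have vA: "\<sigma> v \<in> \<Union>A" using v \<sigma>V by blast
        then have "\<tau> (\<sigma> v) = \<sigma> v" using \<tau>(2) l by blast
        then have vB: "\<sigma> v \<in> \<Union>B" using vA \<tau>V by (metis imageI)
        then have "\<sigma> (\<sigma> v) = \<sigma> v" using \<sigma>(2) l by blast
        then have "\<sigma> v = v" using inj v vB by (meson inj_onD)
        then show False using True l by simp
      qed
      then show ?thesis using True by simp
    qed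
  qed
qed

section \<open>Strict convexity of the total density\<close>

text \<open>This is the \<open>\<Phi>\<close> of the overview. Adding over all targets merges a
  family of inequalities into one, which is strict as soon as a single target separates the two
  graphs.\<close>

definition total_density :: "vertex set \<Rightarrow> vertex set set \<Rightarrow> real" where
  "total_density X E = (\<Sum>G\<in>Pow (Pow X). hom_density {} id X G E)"

lemma total_density_map_edges:
  "inj_on p (\<Union>E) \<Longrightarrow> total_density X (map_edges p E) = total_density X E"
  unfolding total_density_def by (intro sum.cong refl hom_density_map_edges) auto

text \<open>
  Given the images of the labels, the densities of the two factors are independent, so the defect
  in the inequality is a sum of squares of their differences.
\<close>

lemma total_density_strict_convex:
  assumes A: "pl_edges A" "\<Union>A \<subseteq> X" and B: "pl_edges B" "\<Union>B \<subseteq> X" and X: "finite X"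
    and niso: "\<not> pl_iso B A"
  shows "2 * total_density X (glue_edges A B) <
    total_density X (glue_edges A A) + total_density X (glue_edges B B)"
proof -
  \<comment> \<open>The densities divide by a power of \<open>card X\<close>. An empty
    \<open>X\<close> would leave both graphs without edges, hence isomorphic.\<close>
  have X0: "X \<noteq> {}"
  proof
    assume "X = {}"
    then have "e = {}" if "e \<in> A \<union> B" for e using A B that by blast
    then have "A \<union> B = {}" using A(1) B(1) unfolding pl_edges_def
      by (metis Un_iff card.empty equals0I zero_neq_numeral)
    then show False using niso A(1) pl_iso_refl by auto
  qed
  define S where "S = {v \<in> \<Union>A \<union> \<Union>B. vlabel v \<noteq> None}"
  have "finite (\<Union>A \<union> \<Union>B)" using A B finite_verts by blast
  then have finS: "finite S" by (rule finite_subset[rotated]) (auto simp: S_def)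
  have Slab: "S \<subseteq> range Labeled"
  proof
    fix v assume "v \<in> S" then show "v \<in> range Labeled" by (cases v) (auto simp: S_def)
  qed
  define n where "n = real (card X) ^ card S"
  have n: "n > 0" using X X0 by (simp add: n_def card_gt_0_iff)
  define h where "h E G \<phi> = hom_density S \<phi> X G E" for E G \<phi>
  have glue: "total_density X (glue_edges E E') = (\<Sum>G\<in>Pow (Pow X). \<Sum>\<phi>\<in>S \<rightarrow>\<^sub>E X. h E G \<phi> * h E' G \<phi>) / n"
    if "E \<in> {A, B}" "E' \<in> {A, B}" for E E'
    unfolding total_density_def sum_divide_distrib
  proof (rule sum.cong[OF refl])
    fix G
    show "hom_density {} id X G (glue_edges E E') = (\<Sum>\<phi>\<in>S \<rightarrow>\<^sub>E X. h E G \<phi> * h E' G \<phi> / n)"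
      unfolding h_def n_def sum_divide_distrib[symmetric]
      using that A B X X0 finS Slab
      by (intro hom_density_glue) (auto simp: S_def)
  qed
  let ?D = "\<Sum>G\<in>Pow (Pow X). \<Sum>\<phi>\<in>S \<rightarrow>\<^sub>E X. (h A G \<phi> - h B G \<phi>)\<^sup>2"
  have finP: "finite (S \<rightarrow>\<^sub>E X)" using finS X by (simp add: finite_PiE)
  have "?D \<noteq> 0"
  proof
    assume "?D = 0"
    then have "\<forall>G\<in>Pow (Pow X). (\<Sum>\<phi>\<in>S \<rightarrow>\<^sub>E X. (h A G \<phi> - h B G \<phi>)\<^sup>2) = 0"
      using X by (subst (asm) sum_nonneg_eq_0_iff) (auto intro: sum_nonneg)
    then have "\<forall>G\<in>Pow (Pow X). \<forall>\<phi>\<in>S \<rightarrow>\<^sub>E X. (h A G \<phi> - h B G \<phi>)\<^sup>2 = 0"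
      using finP by (simp add: sum_nonneg_eq_0_iff)
    \<comment> \<open>Of all the \<open>\<phi>\<close>, only the one fixing every label is used: it
      makes the surjections below respect labels.\<close>
    moreover have "restrict id S \<in> S \<rightarrow>\<^sub>E X" using A B by (auto simp: S_def)
    ultimately have eq: "hom_density S (restrict id S) X G A = hom_density S (restrict id S) X G B"
      if "G \<subseteq> Pow X" for G
      using that unfolding h_def by fastforce
    have fin: "finite (\<Union>A)" "finite (\<Union>B)" using A B finite_verts by auto
    obtain \<sigma> where \<sigma>: "map_edges \<sigma> B = A" "\<And>v. v \<in> S \<Longrightarrow> \<sigma> v = v"
      by (rule surj_of_hom_density_eq[OF fin(1) A(2) X X0 eq]) (assumption, rule that)
    obtain \<tau> where \<tau>: "map_edges \<tau> A = B" "\<And>v. v \<in> S \<Longrightarrow> \<tau> v = v"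
      by (rule surj_of_hom_density_eq[OF fin(2) B(2) X X0 eq[symmetric]]) (assumption, rule that)
    have "pl_iso B A"
      using \<sigma>(2) \<tau>(2) by (intro pl_iso_of_surj[OF A(1) B(1) \<sigma>(1) _ \<tau>(1)]) (auto simp: S_def)
    with niso show False ..
  qed
  moreover have "?D \<ge> 0" by (intro sum_nonneg) auto
  ultimately have "0 < ?D / n" using n by simp
  also have "?D / n = total_density X (glue_edges A A) + total_density X (glue_edges B B)
      - 2 * total_density X (glue_edges A B)"
    by (simp add: glue power2_diff sum.distrib sum_subtractf sum_distrib_left
        add_divide_distrib diff_divide_distrib mult.assoc)
      (simp add: power2_eq_square)
  finally show ?thesis by simp
qed

lift_definition pl_density :: "vertex set \<Rightarrow> pl_graph \<Rightarrow> real" is total_density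
proof -
  fix X E E' assume "pl_iso E E'"
  then obtain p where "bij_betw p (\<Union>E) (\<Union>E')" "map_edges p E = E'"
    unfolding pl_iso_def by blast
  then show "total_density X E = total_density X E'"
    using total_density_map_edges bij_betw_imp_inj_on by metis
qed

text \<open>With no vertex prescribed, labels do not enter the density. Hence two products with the
  same unlabeled graph have the same density.\<close>

lemma pl_density_erase_labels: "pl_density X (erase_labels H) = pl_density X H"
  by transfer (rule total_density_map_edges[OF inj_on_subset[OF inj_forget]], simp)

text \<open>One \<open>X\<close> must serve all pairs, because the final argument maximises over
  \<open>T\<close>; finitely many representatives fit into one finite vertex set.\<close>

lemma pl_density_strict_convex:
  assumes "finite T"
  obtains X where "\<And>H K. H \<in> T \<Longrightarrow> K \<in> T \<Longrightarrow> H \<noteq> K \<Longrightarrow>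
    2 * pl_density X (H + K) < pl_density X (H + H) + pl_density X (K + K)"
proof -
  have "\<exists>X. finite X \<and> (\<forall>H\<in>T. \<exists>E. pl_edges E \<and> \<Union>E \<subseteq> X \<and> abs_pl_graph E = H)"
    using assms
  proof (induction T)
    case empty then show ?case by blast
  next
    case (insert H T)
    then obtain X where X: "finite X" "\<forall>H\<in>T. \<exists>E. pl_edges E \<and> \<Union>E \<subseteq> X \<and> abs_pl_graph E = H" by blast
    obtain E where E: "pl_edges E" "abs_pl_graph E = H"
      by (metis Quotient_pl_graph Quotient_abs_rep Quotient_rep_reflp pl_iso_edges(1))
    have "finite (X \<union> \<Union>E)" using X(1) E(1) finite_verts by blast
    moreover have "\<exists>D. pl_edges D \<and> \<Union>D \<subseteq> X \<union> \<Union>E \<and> abs_pl_graph D = J" if "J \<in> insert H T" for J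
    proof (cases "J = H")
      case True
      then show ?thesis using E by blast
    next
      case False
      then show ?thesis using that X(2) by (meson insertE le_supI1)
    qed
    ultimately show ?case by blast
  qed
  then obtain X where X: "finite X"
    "\<And>H. H \<in> T \<Longrightarrow> \<exists>E. pl_edges E \<and> \<Union>E \<subseteq> X \<and> abs_pl_graph E = H" by blast
  show thesis
  proof (rule that[of X])
    fix H K assume "H \<in> T" "K \<in> T" "H \<noteq> K"
    then obtain A B where A: "pl_edges A" "\<Union>A \<subseteq> X" "abs_pl_graph A = H"
      and B: "pl_edges B" "\<Union>B \<subseteq> X" "abs_pl_graph B = K" using X(2) by meson
    have "\<not> pl_iso B A"
      using \<open>H \<noteq> K\<close> A(3) B(3) Quotient_rel_abs[OF Quotient_pl_graph, of B A] by auto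
    from total_density_strict_convex[OF A(1,2) B(1,2) X(1) this]
    show "2 * pl_density X (H + K) < pl_density X (H + H) + pl_density X (K + K)"
      unfolding A(3)[symmetric] B(3)[symmetric]
      using A(1) B(1)
      by (simp add: plus_pl_graph.abs_eq pl_density.abs_eq pl_iso_refl pl_edges_glue)
  qed
qed

section \<open>Degrees of products\<close>

definition labeled_edges :: "vertex set set \<Rightarrow> vertex set set" where
  "labeled_edges E = {e \<in> E. \<forall>v\<in>e. vlabel v \<noteq> None}"

text \<open>Inclusion-exclusion: even and odd indices never meet, so an edge comes from both factors
  only if both its ends are labeled and it lies in both graphs.\<close>

lemma card_glue_edges:
  assumes A: "pl_edges A" and B: "pl_edges B"
  shows "card (glue_edges A B) + card (labeled_edges A \<inter> labeled_edges B) = card A + card B"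
proof -
  let ?e = "rename (\<lambda>i. 2 * i)" and ?o = "rename (\<lambda>i. 2 * i + 1)"
  have cd: "card (map_edges (rename g) E) = card E" if "inj g" for g and E :: "vertex set set"
    unfolding map_edges_def
    by (intro card_image inj_on_image inj_on_subset[OF inj_rename[OF that]]) simp
  have fixed: "rename g ` e = e" if "\<forall>v\<in>e. vlabel v \<noteq> None" for g e
  proof -
    have "rename g v = v" if "v \<in> e" for v
      using that \<open>\<forall>v\<in>e. vlabel v \<noteq> None\<close> by (cases v) auto
    then show ?thesis by simp
  qed
  have eo: "vlabel v \<noteq> None" "vlabel w \<noteq> None" if "?e v = ?o w" for v w
    using that by (cases v; cases w; simp; presburger)+
  have "map_edges ?e A \<inter> map_edges ?o B = labeled_edges A \<inter> labeled_edges B"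
  proof (intro equalityI subsetI)
    fix x assume "x \<in> map_edges ?e A \<inter> map_edges ?o B"
    then obtain a b where ab: "a \<in> A" "b \<in> B" "x = ?e ` a" "x = ?o ` b"
      unfolding map_edges_def by blast
    have "\<forall>v\<in>a. vlabel v \<noteq> None" "\<forall>v\<in>b. vlabel v \<noteq> None"
      using ab(3,4) eo by (metis imageE imageI)+
    then show "x \<in> labeled_edges A \<inter> labeled_edges B"
      using ab fixed[of a] fixed[of b] by (simp add: labeled_edges_def)
  next
    fix x assume "x \<in> labeled_edges A \<inter> labeled_edges B"
    then show "x \<in> map_edges ?e A \<inter> map_edges ?o B"
      using fixed[of x] unfolding labeled_edges_def map_edges_def by (metis (mono_tags, lifting) Int_iff image_eqI mem_Collect_eq)
  qed
  moreover have "finite (map_edges ?e A)" "finite (map_edges ?o B)"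
    using A B by (auto simp: pl_edges_def map_edges_def)
  ultimately show ?thesis
    using card_Un_Int[of "map_edges ?e A" "map_edges ?o B"]
    by (simp add: glue_edges_def cd inj_def)
qed

lemma labeled_edges_finite_subset:
  "pl_edges A \<Longrightarrow> finite (labeled_edges A)" "labeled_edges A \<subseteq> A"
  by (auto simp: pl_edges_def labeled_edges_def)

text \<open>With \<open>L\<close> and \<open>M\<close> the labeled edges of the two graphs, the
  right side exceeds the left by \<open>card L + card M - 2 * card (L \<inter> M)\<close>.\<close>

lemma degree_convex: "degree (H + H) + degree (K + K) \<le> 2 * degree (H + K)"
proof (transfer, goal_cases)
  case (1 A B)
  then have A: "pl_edges A" and B: "pl_edges B" using pl_iso_edges by blast+
  have "card (labeled_edges A \<inter> labeled_edges B) \<le> card (labeled_edges A)"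
    "card (labeled_edges A \<inter> labeled_edges B) \<le> card (labeled_edges B)"
    using A B labeled_edges_finite_subset by (auto intro: card_mono)
  then show ?case
    using card_glue_edges[OF A A] card_glue_edges[OF B B] card_glue_edges[OF A B] by simp
qed

text \<open>Equality in \<open>degree_convex\<close> forces equal sets of labeled edges. For
  \<open>H\<close> this set is everything, and equal degrees of the squares leave \<open>K\<close>
  no further edge.\<close>

lemma fully_labeled_eq_of_degree:
  assumes "fully_labeled H" "degree (H + H) = d" "degree (K + K) = d" "degree (H + K) = d"
  shows "H = K"
  using assms
proof (transfer, goal_cases)
  case (1 A d B)
  then have A: "pl_edges A" and B: "pl_edges B" using pl_iso_edges by blast+
  let ?L = "labeled_edges A" and ?M = "labeled_edges B"
  have LA: "?L = A" using 1 by (auto simp: labeled_edges_def)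
  have le: "card (?L \<inter> ?M) \<le> card ?L" "card (?L \<inter> ?M) \<le> card ?M"
    using A B labeled_edges_finite_subset by (auto intro: card_mono)
  have cB: "card ?M \<le> card B"
    using B labeled_edges_finite_subset(2) by (auto intro: card_mono simp: pl_edges_def)
  have "card (?L \<inter> ?M) = card ?L" "card (?L \<inter> ?M) = card ?M" "card ?M = card B"
    using 1 le cB LA card_glue_edges[OF A A] card_glue_edges[OF B B] card_glue_edges[OF A B] by simp_all
  moreover have "finite ?L" "finite ?M" "finite B"
    using A B labeled_edges_finite_subset(1) by (simp_all add: pl_edges_def)
  ultimately have "?L \<inter> ?M = ?L" "?L \<inter> ?M = ?M" "?M = B"
    using labeled_edges_finite_subset(2)[of B] by (simp_all add: card_subset_eq)
  then have "A = B" using LA by simp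
  then show ?case using A pl_iso_refl by simp
qed

lemma degree_erase_labels: "degree (erase_labels H) = degree H"
  by transfer (simp add: map_edges_def card_image inj_on_image inj_on_subset[OF inj_forget])

section \<open>Coefficients of sums of squares\<close>

lemma lookup_unlabel_square:
  "Poly_Mapping.lookup (unlabel (a\<^sup>2)) F =
    (\<Sum>H\<in>Poly_Mapping.keys a. \<Sum>K\<in>Poly_Mapping.keys a.
      if erase_labels (H + K) = F then Poly_Mapping.lookup a H * Poly_Mapping.lookup a K else 0)"
proof -
  let ?k = "Poly_Mapping.keys a" and ?c = "Poly_Mapping.lookup a"
  have a: "a = (\<Sum>H\<in>?k. Poly_Mapping.single H (?c H))"
    by (rule poly_mapping_eqI) (simp add: lookup_sum lookup_single when_def in_keys_iff)
  have unl_sum: "unlabel (\<Sum>x\<in>I. g x) = (\<Sum>x\<in>I. unlabel (g x))" for g :: "pl_graph \<Rightarrow> graph_comb" and I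
    by (induction I rule: infinite_finite_induct) (simp_all add: unlabel_add, simp_all add: unlabel_def)
  have "a\<^sup>2 = (\<Sum>H\<in>?k. \<Sum>K\<in>?k. Poly_Mapping.single (H + K) (?c H * ?c K))"
    unfolding power2_eq_square by (subst (1 2) a) (simp add: sum_product mult_single)
  then show ?thesis
    by (simp add: unl_sum unlabel_single lookup_sum lookup_single when_def)
qed

text \<open>The cross terms are excluded for each \<open>i\<close> separately, since only graphs of
  the same \<open>a i\<close> are multiplied. The remaining sum has an evident sign.\<close>

lemma lookup_sum_squares_diagonal:
  fixes n :: nat and a :: "nat \<Rightarrow> graph_comb"
  assumes diag: "\<And>i H K. i < n \<Longrightarrow> H \<in> Poly_Mapping.keys (a i) \<Longrightarrow> K \<in> Poly_Mapping.keys (a i) \<Longrightarrow>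
      erase_labels (H + K) = F \<Longrightarrow> H = K"
  shows "Poly_Mapping.lookup (\<Sum>i<n. unlabel ((a i)\<^sup>2)) F =
    (\<Sum>i<n. \<Sum>H\<in>Poly_Mapping.keys (a i).
      if erase_labels (H + H) = F then (Poly_Mapping.lookup (a i) H)\<^sup>2 else 0)"
  unfolding lookup_sum lookup_unlabel_square
proof (intro sum.cong refl)
  fix i H assume i: "i \<in> {..<n}" and H: "H \<in> Poly_Mapping.keys (a i)"
  have "(\<Sum>K\<in>Poly_Mapping.keys (a i). if erase_labels (H + K) = F
      then Poly_Mapping.lookup (a i) H * Poly_Mapping.lookup (a i) K else 0)
    = (\<Sum>K\<in>Poly_Mapping.keys (a i). if K = H then if erase_labels (H + H) = F
      then (Poly_Mapping.lookup (a i) H)\<^sup>2 else 0 else 0)"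
    using diag i H by (intro sum.cong) (auto simp: power2_eq_square)
  then show "(\<Sum>K\<in>Poly_Mapping.keys (a i). if erase_labels (H + K) = F
      then Poly_Mapping.lookup (a i) H * Poly_Mapping.lookup (a i) K else 0)
    = (if erase_labels (H + H) = F then (Poly_Mapping.lookup (a i) H)\<^sup>2 else 0)"
    using H by simp
qed

lemma lookup_sum_squares_diagonal_nonneg:
  fixes n :: nat and a :: "nat \<Rightarrow> graph_comb"
  assumes "\<And>i H K. i < n \<Longrightarrow> H \<in> Poly_Mapping.keys (a i) \<Longrightarrow> K \<in> Poly_Mapping.keys (a i) \<Longrightarrow>
      erase_labels (H + K) = F \<Longrightarrow> H = K"
  shows "0 \<le> Poly_Mapping.lookup (\<Sum>i<n. unlabel ((a i)\<^sup>2)) F"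
  by (subst lookup_sum_squares_diagonal[OF assms]) (simp_all add: sum_nonneg)

lemma lookup_sum_squares_diagonal_pos:
  fixes n :: nat and a :: "nat \<Rightarrow> graph_comb"
  assumes "\<And>i H K. i < n \<Longrightarrow> H \<in> Poly_Mapping.keys (a i) \<Longrightarrow> K \<in> Poly_Mapping.keys (a i) \<Longrightarrow>
      erase_labels (H + K) = F \<Longrightarrow> H = K"
    and "i < n" "H \<in> Poly_Mapping.keys (a i)" "erase_labels (H + H) = F"
  shows "0 < Poly_Mapping.lookup (\<Sum>i<n. unlabel ((a i)\<^sup>2)) F"
proof -
  define c where "c j K = (if erase_labels (K + K) = F then (Poly_Mapping.lookup (a j) K)\<^sup>2 else 0)" for j K
  have c: "0 \<le> c j K" for j K by (simp add: c_def)
  have "0 < c i H" using assms(3,4) by (simp add: c_def in_keys_iff)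
  then have "0 < (\<Sum>K\<in>Poly_Mapping.keys (a i). c i K)"
    using assms(3) c by (intro sum_pos2[of _ H]) auto
  then have "0 < (\<Sum>j<n. \<Sum>K\<in>Poly_Mapping.keys (a j). c j K)"
    using assms(2) c by (intro sum_pos2[of _ i]) (auto intro: sum_nonneg)
  then show ?thesis by (subst lookup_sum_squares_diagonal[OF assms(1)]) (simp_all add: c_def)
qed

section \<open>Lowest-degree coefficients and the contradiction\<close>

lemma trivial_squareD: "trivial_square (erase_labels (H + H)) \<Longrightarrow> fully_labeled H"
proof -
  assume "trivial_square (erase_labels (H + H))"
  moreover have "Poly_Mapping.single (erase_labels (H + H)) 1 = unlabel ((Poly_Mapping.single H 1)\<^sup>2)"
    by (simp add: power2_eq_square mult_single unlabel_single)
  ultimately show "fully_labeled H" unfolding trivial_square_def by blast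
qed

text \<open>The cases are whether some graph attaining the least degree of a square fails to be
  fully labeled. \<open>F0\<close> guarantees that a graph occurs at all and bounds this degree; the
  positive coefficient later forces it to equal \<open>d_min\<close>.\<close>

lemma sos_lowest_degree:
  fixes n :: nat and a :: "nat \<Rightarrow> graph_comb"
  assumes f: "f = (\<Sum>i<n. unlabel ((a i)\<^sup>2))" and nz: "Poly_Mapping.lookup f F0 \<noteq> 0"
  obtains (nontrivial) H where "0 < Poly_Mapping.lookup f (erase_labels (H + H))" "\<not> fully_labeled H"
      "degree (H + H) \<le> degree F0"
    | (trivial) H where "0 < Poly_Mapping.lookup f (erase_labels (H + H))" "degree (H + H) \<le> degree F0"
      "\<And>F. degree F = degree (H + H) \<Longrightarrow> 0 \<le> Poly_Mapping.lookup f F"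
proof -
  define T where "T = (\<Union>i<n. Poly_Mapping.keys (a i))"
  have T: "finite T" by (simp add: T_def)
  obtain i H K where ne: "i < n" "H \<in> Poly_Mapping.keys (a i)" "K \<in> Poly_Mapping.keys (a i)"
    "erase_labels (H + K) = F0"
  proof -
    have "\<exists>i<n. \<exists>H\<in>Poly_Mapping.keys (a i). \<exists>K\<in>Poly_Mapping.keys (a i). erase_labels (H + K) = F0"
    proof (rule ccontr)
      assume "\<not> ?thesis"
      then have "Poly_Mapping.lookup f F0 = 0"
        unfolding f lookup_sum lookup_unlabel_square
        by (intro sum.neutral ballI if_not_P) (metis lessThan_iff)
      with nz show False ..
    qed
    then show thesis using that by blast
  qed
  then have HKT: "H \<in> T" "K \<in> T" by (auto simp: T_def)
  define d where "d = Min ((\<lambda>H. degree (H + H)) ` T)"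
  have dmin: "d \<le> degree (J + J)" if "J \<in> T" for J
    using T that by (simp add: d_def)
  have "d \<in> (\<lambda>H. degree (H + H)) ` T"
    unfolding d_def using T HKT by (intro Min_in) auto
  then obtain J where J: "J \<in> T" "degree (J + J) = d" by auto
  have dF0: "d \<le> degree F0"
    using degree_convex[of H K] dmin[OF HKT(1)] dmin[OF HKT(2)] degree_erase_labels[of "H + K"]
    unfolding ne(4) by linarith
  \<comment> \<open>Both squares have degree at least \<open>d\<close>, so
    \<open>degree_convex\<close> is tight here.\<close>
  have deg_d: "degree (A + A) = d \<and> degree (B + B) = d"
    if "A \<in> T" "B \<in> T" "degree (A + B) = d" for A B
    using degree_convex[of A B] dmin[OF that(1)] dmin[OF that(2)] that(3) by linarith
  have full: "A = B" if "A \<in> T" "B \<in> T" "degree (A + B) = d" "fully_labeled A \<or> fully_labeled B" for A B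
    using fully_labeled_eq_of_degree[of A d B] fully_labeled_eq_of_degree[of B d A] deg_d[OF that(1-3)]
      that(3,4) by (auto simp: add.commute)
  define N where "N = {A \<in> T. degree (A + A) = d \<and> \<not> fully_labeled A}"
  show thesis
  proof (cases "N = {}")
    case True
    have diag: "A = B" if "A \<in> T" "B \<in> T" "degree (A + B) = d" for A B
      using that full deg_d True by (auto simp: N_def)
    have diag': "A = B" if "degree F = d" "i < n" "A \<in> Poly_Mapping.keys (a i)"
      "B \<in> Poly_Mapping.keys (a i)" "erase_labels (A + B) = F" for i A B F
      by (rule diag) (use that in \<open>auto simp: T_def degree_erase_labels\<close>)
    obtain j where j: "j < n" "J \<in> Poly_Mapping.keys (a j)" using J by (auto simp: T_def)
    show thesis
    proof (rule trivial)
      show "0 < Poly_Mapping.lookup f (erase_labels (J + J))"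
        unfolding f
      proof (rule lookup_sum_squares_diagonal_pos[where i = j and H = J])
        show "A = B" if "i < n" "A \<in> Poly_Mapping.keys (a i)" "B \<in> Poly_Mapping.keys (a i)"
          "erase_labels (A + B) = erase_labels (J + J)" for i A B
          by (rule diag'[OF _ that]) (use J in \<open>simp add: degree_erase_labels\<close>)
      qed (use j in simp_all)
      show "degree (J + J) \<le> degree F0" using J dF0 by simp
      show "0 \<le> Poly_Mapping.lookup f F" if "degree F = degree (J + J)" for F
        unfolding f
      proof (rule lookup_sum_squares_diagonal_nonneg)
        show "A = B" if "i < n" "A \<in> Poly_Mapping.keys (a i)" "B \<in> Poly_Mapping.keys (a i)"
          "erase_labels (A + B) = F" for i A B
          by (rule diag'[OF _ that]) (use J \<open>degree F = degree (J + J)\<close> in simp)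
      qed
    qed
  next
    case False
    obtain X where X: "\<And>H K. H \<in> T \<Longrightarrow> K \<in> T \<Longrightarrow> H \<noteq> K \<Longrightarrow>
        2 * pl_density X (H + K) < pl_density X (H + H) + pl_density X (K + K)"
      using pl_density_strict_convex[OF T] by blast
    have finN: "finite N" using T by (simp add: N_def)
    have "Max ((\<lambda>A. pl_density X (A + A)) ` N) \<in> (\<lambda>A. pl_density X (A + A)) ` N"
      using finN False by (intro Max_in) auto
    then obtain M where M: "M \<in> N" "Max ((\<lambda>A. pl_density X (A + A)) ` N) = pl_density X (M + M)"
      by auto
    have Mmax: "pl_density X (A + A) \<le> pl_density X (M + M)" if "A \<in> N" for A
      using finN that by (simp flip: M(2))
    have diag: "A = B" if AB: "i < n" "A \<in> Poly_Mapping.keys (a i)" "B \<in> Poly_Mapping.keys (a i)"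
      "erase_labels (A + B) = erase_labels (M + M)" for i A B
    proof (rule ccontr)
      assume "A \<noteq> B"
      have T: "A \<in> T" "B \<in> T" using AB by (auto simp: T_def)
      have "degree (A + B) = d" using AB(4) M(1) degree_erase_labels by (metis (mono_tags, lifting) N_def mem_Collect_eq)
      \<comment> \<open>If either factor were fully labeled, \<open>full\<close> would give
        \<open>A = B\<close>.\<close>
      then have "A \<in> N" "B \<in> N" using T \<open>A \<noteq> B\<close> full[OF T] deg_d[OF T] by (auto simp: N_def)
      then have "2 * pl_density X (A + B) < 2 * pl_density X (M + M)"
        using X[OF T \<open>A \<noteq> B\<close>] Mmax[of A] Mmax[of B] by linarith
      \<comment> \<open>The products \<open>A + B\<close> and \<open>M + M\<close> agree after
        erasing labels, so their densities agree.\<close>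
      then show False using AB(4) pl_density_erase_labels[of X] by (metis less_irrefl)
    qed
    obtain m where m: "m < n" "M \<in> Poly_Mapping.keys (a m)" using M by (auto simp: N_def T_def)
    show thesis
    proof (rule nontrivial)
      show "0 < Poly_Mapping.lookup f (erase_labels (M + M))"
        unfolding f
      proof (rule lookup_sum_squares_diagonal_pos[where i = m and H = M])
        show "A = B" if "i < n" "A \<in> Poly_Mapping.keys (a i)" "B \<in> Poly_Mapping.keys (a i)"
          "erase_labels (A + B) = erase_labels (M + M)" for i A B
          by (rule diag[OF that])
      qed (use m in simp_all)
      show "\<not> fully_labeled M" "degree (M + M) \<le> degree F0" using M dF0 by (auto simp: N_def)
    qed
  qed
qed

theorem theorem1p2:
  fixes f :: graph_comb and F :: "nat \<Rightarrow> pl_graph" and lam :: "nat \<Rightarrow> real" and t d_min :: nat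
  assumes "f = (\<Sum>s\<in>{1..t}. Poly_Mapping.single (F s) (lam s))"
    and "\<forall>s\<in>{1..t}. unlabeled (F s)"
    and "inj_on F {1..t}"
    and "d_min = Min ((\<lambda>s. degree (F s)) ` {1..t})"
    and "\<exists>s\<in>{1..t}. degree (F s) = d_min \<and> lam s < 0"
    and "\<forall>s\<in>{1..t}. degree (F s) = d_min \<and> lam s > 0 \<longrightarrow> trivial_square (F s)"
  shows "\<not> is_sos f"
proof
  assume "is_sos f"
  then obtain n :: nat and a :: "nat \<Rightarrow> graph_comb" where f: "f = (\<Sum>i<n. unlabel ((a i)\<^sup>2))" unfolding is_sos_def by blast
  have coeff: "Poly_Mapping.lookup f (F s) = lam s" if "s \<in> {1..t}" for s
  proof -
    have "Poly_Mapping.lookup f (F s) = (\<Sum>r\<in>{1..t}. if r = s then lam r else 0)"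
      unfolding assms(1) lookup_sum lookup_single when_def
      by (rule sum.cong) (use inj_onD[OF assms(3) _ _ that] in auto)
    then show ?thesis using that by simp
  qed
  have supp: "\<exists>s\<in>{1..t}. G = F s" if "Poly_Mapping.lookup f G \<noteq> 0" for G
  proof (rule ccontr)
    assume "\<not> ?thesis"
    then have "Poly_Mapping.lookup f G = 0"
      unfolding assms(1) lookup_sum lookup_single when_def by (auto intro!: sum.neutral)
    with that show False ..
  qed
  have dmin: "d_min \<le> degree (F s)" if "s \<in> {1..t}" for s
    unfolding assms(4) using that by (intro Min_le) auto
  obtain s0 where s0: "s0 \<in> {1..t}" "degree (F s0) = d_min" "lam s0 < 0" using assms(5) by blast
  \<comment> \<open>A positive coefficient identifies the square with some \<open>F s\<close>, of
    degree at least \<open>d_min\<close>; the upper bound through \<open>s0\<close> makes this an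
    equality.\<close>
  have lowest: "\<exists>s\<in>{1..t}. erase_labels (H + H) = F s \<and> degree (F s) = d_min \<and> 0 < lam s"
    if pos: "0 < Poly_Mapping.lookup f (erase_labels (H + H))" and le: "degree (H + H) \<le> degree (F s0)" for H
  proof -
    from pos obtain s where s: "s \<in> {1..t}" "erase_labels (H + H) = F s"
      using supp by (metis less_irrefl)
    then show ?thesis
      using dmin[OF s(1)] pos le s0(2) coeff[OF s(1)] degree_erase_labels[of "H + H"] by fastforce
  qed
  have nz: "Poly_Mapping.lookup f (F s0) \<noteq> 0" using coeff s0 by simp
  show False
  proof (cases rule: sos_lowest_degree[OF f nz])
    case (1 H)
    then show False using lowest assms(6) trivial_squareD by metis
  next
    case (2 H)
    \<comment> \<open>Only now is the degree of the square known to be that of \<open>F s0\<close>,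
      so that nonnegativity applies to \<open>lam s0\<close>.\<close>
    then have "degree (H + H) = d_min" using lowest degree_erase_labels by metis
    then have "0 \<le> lam s0" using 2(3)[of "F s0"] s0 coeff by simp
    then show False using s0 by simp
  qed
qed

end
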